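(* Let $S$ be an ordered semigroup (without zero) which is both right inverse and left group like. Then $S$ is a group like ordered semigroup.
   Context: An ordered semigroup $(S,\cdot,\leq)$ is a semigroup with a partial order such that $a\leq b$ implies $xa\leq xb$ and $ax\leq bx$ for all $x\in S$. Standing assumption: the ambient ordered semigroup $S$ has no zero element (an element $0$ with $0x=x0=0$ and $0\leq x$ for all $x\in S$). For $H\subseteq S$, $(H]=\{t\in S: t\leq h \text{ for some } h\in H\}$. For $a\in S$: $aS=\{as:s\in S\}$, $Sa=\{sa:s\in S\}$, $aSa=\{asa:s\in S\}$. $S$ is regular if $a\in (aSa]$ for every $a\in S$. A regular ordered semigroup $S$ is group like if for all $a,b\in S$, $a\in (Sb]$ and $b\in (aS]$; it is left group like if for all $a,b\in S$, $a\in (Sb]$. A nonempty $I\subseteq S$ is a left (right) ideal if $SI\subseteq I$ ($IS\subseteq I$) and $(I]\subseteq I$. $L(a)$ and $R(a)$ denote the smallest left, respectively right, ideal containing $a$. Green's relation: $a\,\mathcal{R}\,b$ iff $R(a)=R(b)$. $E_{\leq}(S)=\{e\in S: e\leq e^2\}$ is the set of ordered idempotents. $S$ is right inverse if it is regular and every principal left ideal is generated by an $\mathcal{R}$-unique ordered idempotent, i.e. for every $a\in S$ there is $e\in E_{\leq}(S)$ with $L(a)=L(e)$, and any two $e,f\in E_{\leq}(S)$ with $L(e)=L(a)=L(f)$ satisfy $e\,\mathcal{R}\,f$. *)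

theory Defs
  imports Main "HOL.Hull"
begin

text \<open>The ordered semigroup \<open>S\<close> is a type of the following class, so \<open>S\<close> itself is \<^term>\<open>UNIV\<close>;
  properties of \<open>S\<close> as a whole are predicates on the type token \<open>TYPE('a)\<close>.\<close>

class ordered_semigroup_mult = semigroup_mult + order +
  assumes mult_left_mono_os: "a \<le> b \<Longrightarrow> x * a \<le> x * b"
    and mult_right_mono_os: "a \<le> b \<Longrightarrow> a * x \<le> b * x"

definition is_zero :: "'a::ordered_semigroup_mult \<Rightarrow> bool" where
  "is_zero z \<longleftrightarrow> (\<forall>x. z * x = z \<and> x * z = z \<and> z \<le> x)"

definition has_no_zero :: "'a::ordered_semigroup_mult itself \<Rightarrow> bool" where
  "has_no_zero _ \<longleftrightarrow> \<not> (\<exists>z::'a. is_zero z)"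

definition down :: "'a::ordered_semigroup_mult set \<Rightarrow> 'a set" where
  "down H = {t. \<exists>h\<in>H. t \<le> h}"

definition regular_os :: "'a::ordered_semigroup_mult itself \<Rightarrow> bool" where
  "regular_os _ \<longleftrightarrow> (\<forall>a::'a. a \<in> down {a * s * a | s. True})"

definition group_like :: "'a::ordered_semigroup_mult itself \<Rightarrow> bool" where
  "group_like T \<longleftrightarrow> regular_os T \<and>
     (\<forall>a b::'a. a \<in> down {s * b | s. True} \<and> b \<in> down {a * s | s. True})"

definition left_group_like :: "'a::ordered_semigroup_mult itself \<Rightarrow> bool" where
  "left_group_like T \<longleftrightarrow> regular_os T \<and> (\<forall>a b::'a. a \<in> down {s * b | s. True})"

definition left_ideal :: "'a::ordered_semigroup_mult set \<Rightarrow> bool" where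
  "left_ideal I \<longleftrightarrow> I \<noteq> {} \<and> (\<forall>s. \<forall>x\<in>I. s * x \<in> I) \<and> down I \<subseteq> I"

definition right_ideal :: "'a::ordered_semigroup_mult set \<Rightarrow> bool" where
  "right_ideal I \<longleftrightarrow> I \<noteq> {} \<and> (\<forall>x\<in>I. \<forall>s. x * s \<in> I) \<and> down I \<subseteq> I"

text \<open>The intersection of all left (right) ideals containing \<open>a\<close>; the lemmas after the definitions
  show that it is itself such an ideal, hence the smallest one.\<close>

definition principal_left_ideal :: "'a::ordered_semigroup_mult \<Rightarrow> 'a set" where
  "principal_left_ideal a = left_ideal hull {a}"

definition principal_right_ideal :: "'a::ordered_semigroup_mult \<Rightarrow> 'a set" where
  "principal_right_ideal a = right_ideal hull {a}"

lemma principal_left_ideal_iff: "x \<in> principal_left_ideal a \<longleftrightarrow> (\<forall>I. left_ideal I \<longrightarrow> a \<in> I \<longrightarrow> x \<in> I)"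
  by (auto simp: principal_left_ideal_def hull_def)

lemma principal_left_ideal_smallest:
  "left_ideal (principal_left_ideal a)"
  "a \<in> principal_left_ideal a"
  "left_ideal I \<Longrightarrow> a \<in> I \<Longrightarrow> principal_left_ideal a \<subseteq> I"
proof -
  show mem: "a \<in> principal_left_ideal a"
    by (simp add: principal_left_ideal_iff)
  show "left_ideal I \<Longrightarrow> a \<in> I \<Longrightarrow> principal_left_ideal a \<subseteq> I"
    by (simp add: principal_left_ideal_iff subset_iff)
  have mult: "s * x \<in> principal_left_ideal a" if "x \<in> principal_left_ideal a" for s x
    using that by (simp add: principal_left_ideal_iff left_ideal_def)
  have "t \<in> principal_left_ideal a" if h: "h \<in> principal_left_ideal a" and th: "t \<le> h" for t h
    unfolding principal_left_ideal_iff
  proof (intro allI impI)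
    fix I assume I: "left_ideal I" "a \<in> I"
    then have "h \<in> I" using h by (simp add: principal_left_ideal_iff)
    then have "t \<in> down I" using th by (auto simp: down_def)
    then show "t \<in> I" using I by (auto simp: left_ideal_def)
  qed
  then have "down (principal_left_ideal a) \<subseteq> principal_left_ideal a"
    unfolding down_def by blast
  with mem mult show "left_ideal (principal_left_ideal a)"
    unfolding left_ideal_def by blast
qed

lemma principal_right_ideal_iff: "x \<in> principal_right_ideal a \<longleftrightarrow> (\<forall>I. right_ideal I \<longrightarrow> a \<in> I \<longrightarrow> x \<in> I)"
  by (auto simp: principal_right_ideal_def hull_def)

lemma principal_right_ideal_smallest:
  "right_ideal (principal_right_ideal a)"
  "a \<in> principal_right_ideal a"
  "right_ideal I \<Longrightarrow> a \<in> I \<Longrightarrow> principal_right_ideal a \<subseteq> I"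
proof -
  show mem: "a \<in> principal_right_ideal a"
    by (simp add: principal_right_ideal_iff)
  show "right_ideal I \<Longrightarrow> a \<in> I \<Longrightarrow> principal_right_ideal a \<subseteq> I"
    by (simp add: principal_right_ideal_iff subset_iff)
  have mult: "x * s \<in> principal_right_ideal a" if "x \<in> principal_right_ideal a" for s x
    using that by (simp add: principal_right_ideal_iff right_ideal_def)
  have "t \<in> principal_right_ideal a" if h: "h \<in> principal_right_ideal a" and th: "t \<le> h" for t h
    unfolding principal_right_ideal_iff
  proof (intro allI impI)
    fix I assume I: "right_ideal I" "a \<in> I"
    then have "h \<in> I" using h by (simp add: principal_right_ideal_iff)
    then have "t \<in> down I" using th by (auto simp: down_def)
    then show "t \<in> I" using I by (auto simp: right_ideal_def)
  qed
  then have "down (principal_right_ideal a) \<subseteq> principal_right_ideal a"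
    unfolding down_def by blast
  with mem mult show "right_ideal (principal_right_ideal a)"
    unfolding right_ideal_def by blast
qed

definition green_R :: "'a::ordered_semigroup_mult \<Rightarrow> 'a \<Rightarrow> bool" where
  "green_R a b \<longleftrightarrow> principal_right_ideal a = principal_right_ideal b"

definition ordered_idempotents :: "'a::ordered_semigroup_mult set" where
  "ordered_idempotents = {e. e \<le> e * e}"

definition right_inverse_os :: "'a::ordered_semigroup_mult itself \<Rightarrow> bool" where
  "right_inverse_os T \<longleftrightarrow> regular_os T \<and>
     (\<forall>a::'a.
        (\<exists>e\<in>ordered_idempotents. principal_left_ideal a = principal_left_ideal e) \<and>
        (\<forall>e\<in>ordered_idempotents. \<forall>f\<in>ordered_idempotents.
           principal_left_ideal e = principal_left_ideal a \<and>
           principal_left_ideal a = principal_left_ideal f \<longrightarrow> green_R e f))"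

end

theory Submission
  imports Defs
begin

text \<open>In a left group like semigroup every principal left ideal is the whole semigroup, so right
  inversity makes any two ordered idempotents \<open>\<R>\<close>-related. Regularity gives \<open>a \<le> a s a\<close> and
  \<open>b \<le> b t b\<close>; the ordered idempotents \<open>a s\<close> and \<open>b t\<close> generate the same right ideal, which lies in
  \<open>(aS]\<close>. Hence \<open>b t \<le> a u\<close> for some \<open>u\<close>, and \<open>b \<le> b t b \<le> a (u b)\<close>.\<close>

text \<open>This bounds the right ideal generated by any \<open>a * s\<close>, by minimality of
  principal right ideals. Without regularity \<open>a\<close> itself may lie outside the set, so
  \<open>a * a\<close> witnesses nonemptiness.\<close>

lemma right_ideal_down_mult: "right_ideal (down {a * s | s. True})"
proof -
  have "x * r \<in> down {a * s | s. True}" if x: "x \<in> down {a * s | s. True}" for x r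
  proof -
    from x obtain s where "x \<le> a * s" by (auto simp: down_def)
    then have "x * r \<le> a * (s * r)" by (metis mult_right_mono_os mult.assoc)
    then show ?thesis by (auto simp: down_def)
  qed
  moreover have "a * a \<in> down {a * s | s. True}" by (auto simp: down_def)
  moreover have "down (down {a * s | s. True}) \<subseteq> down {a * s | s. True}"
    unfolding down_def by (blast intro: order_trans)
  ultimately show ?thesis unfolding right_ideal_def by blast
qed

lemma left_group_like_principal_left_ideal:
  assumes "left_group_like TYPE('a::ordered_semigroup_mult)"
  shows "principal_left_ideal (a::'a) = UNIV"
proof -
  have "x \<in> principal_left_ideal a" for x
  proof -
    have "x \<in> down {s * a | s. True}"
      using assms by (simp add: left_group_like_def)
    then obtain s where "x \<le> s * a" by (auto simp: down_def)
    moreover have "s * a \<in> principal_left_ideal a"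
      using principal_left_ideal_smallest(1,2)[of a] unfolding left_ideal_def by blast
    ultimately have "x \<in> down (principal_left_ideal a)" by (auto simp: down_def)
    then show ?thesis
      using principal_left_ideal_smallest(1)[of a] unfolding left_ideal_def by blast
  qed
  then show ?thesis by blast
qed

lemma regular_os_obtain_idempotent:
  assumes "regular_os TYPE('a::ordered_semigroup_mult)"
  obtains s where "(a::'a) \<le> a * s * a" and "a * s \<in> ordered_idempotents"
proof -
  from assms have "a \<in> down {a * s * a | s. True}" by (simp add: regular_os_def)
  then obtain s where s: "a \<le> a * s * a" by (auto simp: down_def)
  \<comment> \<open>Multiply \<open>a \<le> a * s * a\<close> by \<open>s\<close> on the
    right.\<close>
  then have "a * s \<le> (a * s) * (a * s)" by (metis mult_right_mono_os mult.assoc)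
  with s show thesis by (intro that) (simp_all add: ordered_idempotents_def)
qed

theorem corollary3p4:
  assumes "has_no_zero TYPE('a::ordered_semigroup_mult)"
    and "right_inverse_os TYPE('a)"
    and "left_group_like TYPE('a)"
  shows "group_like TYPE('a)"
proof -
  have reg: "regular_os TYPE('a)" using assms(3) by (simp add: left_group_like_def)
  have left: "a \<in> down {s * b | s. True}" for a b :: 'a
    using assms(3) by (simp add: left_group_like_def)
  have right: "b \<in> down {a * s | s. True}" for a b :: 'a
  proof -
    obtain s where s: "a * s \<in> ordered_idempotents"
      using regular_os_obtain_idempotent[OF reg] by metis
    obtain t where t: "b \<le> b * t * b" "b * t \<in> ordered_idempotents"
      using regular_os_obtain_idempotent[OF reg] by metis
    \<comment> \<open>Both idempotents generate the left ideal \<open>UNIV\<close>, so the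
      uniqueness clause of right inversity compares them.\<close>
    have "green_R (a * s) (b * t)"
      using assms(2) s t(2) left_group_like_principal_left_ideal[OF assms(3)]
      unfolding right_inverse_os_def by blast
    then have "b * t \<in> principal_right_ideal (a * s)"
      using principal_right_ideal_smallest(2)[of "b * t"] by (simp add: green_R_def)
    moreover have "a * s \<in> down {a * s | s. True}" by (auto simp: down_def)
    \<comment> \<open>The right ideal \<open>(aS]\<close> contains \<open>a * s\<close>, hence all
      of \<open>principal_right_ideal (a * s)\<close>.\<close>
    ultimately have "b * t \<in> down {a * s | s. True}"
      using principal_right_ideal_smallest(3)[OF right_ideal_down_mult] by blast
    then obtain u where "b * t \<le> a * u" by (auto simp: down_def)
    then have "b * t * b \<le> a * (u * b)" by (metis mult_right_mono_os mult.assoc)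
    with t(1) have "b \<le> a * (u * b)" by (rule order_trans)
    then show ?thesis by (auto simp: down_def)
  qed
  show ?thesis using reg left right unfolding group_like_def by blast
qed

end
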